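(* Let $L\ge\mu>0$ and let $F:\mathbb R^n\to\mathbb R$ be $C^1$, $\mu$-strongly convex and with $L$-Lipschitz continuous gradient; let $x^*$ be its minimizer. Let $s>0$, $\eta>0$ and let $\{(x_k,w_k)\}_{k\ge0}\subset\mathbb R^n\times\mathbb R^n$ be generated by $$\left\{\begin{aligned}\frac{x_{k+1}-x_k}{\sqrt{s}}&=\sqrt{\mu}\,(1-3\eta\sqrt{\mu s})(w_k-x_{k+1})-\frac32\eta\sqrt{s}\,\nabla F(x_k),\\ \frac{w_{k+1}-w_k}{\sqrt{s}}&=-\frac{\sqrt{\mu}}{2}(2+5\eta\sqrt{\mu s})(w_{k+1}-x_{k+1})-\frac{1}{2\sqrt{\mu}}(2+5\eta\sqrt{\mu s})\nabla F(x_{k+1}).\end{aligned}\right.$$ Assume $3\eta\sqrt{\mu s}<1$ and $$9L\eta^2s+4\left(1+\tfrac{5}{2}\eta\sqrt{\mu s}\right)(1-3\eta\sqrt{\mu s})\le12\eta.$$ Define $$\mathcal E_k=F(x_k)-F(x^* )+\frac b2\|w_k-x^*\|^2,\qquad b=\frac{\mu(1-3\eta\sqrt{\mu s})}{1+\frac52\eta\sqrt{\mu s}}.$$ Then for all $k\in\mathbb N$ $$\mathcal E_{k+1}-\mathcal E_k\le-\sqrt{\mu s}\,(1-3\eta\sqrt{\mu s})\,\mathcal E_{k+1},$$ which implies $$\mathcal E_k\le\left(1+\sqrt{\mu s}\,(1-3\eta\sqrt{\mu s})\right)^{-k}\mathcal E_0\quad\text{for all }k\in\mathbb N.$$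
   Context: $F$ being $\mu$-strongly convex means $F(y)\ge F(x)+\langle\nabla F(x),y-x\rangle+\frac\mu2\|x-y\|^2$ for all $x,y\in\mathbb R^n$. *)

theory Defs
  imports "HOL-Analysis.Analysis"
begin

text \<open>The argument \<open>gF\<close> stands for the gradient of \<open>F\<close>, so the definition is meant to be used
  together with \<open>\<forall>x. GDERIV F x :> gF x\<close>, which determines \<open>gF\<close> uniquely.\<close>

definition strongly_convex ::
  "real \<Rightarrow> ('a::real_inner \<Rightarrow> real) \<Rightarrow> ('a \<Rightarrow> 'a) \<Rightarrow> bool" where
  "strongly_convex \<mu> F gF \<longleftrightarrow>
     (\<forall>x y. F y \<ge> F x + gF x \<bullet> (y - x) + \<mu> / 2 * (norm (x - y))\<^sup>2)"

end

theory Submission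
  imports Defs
begin

text \<open>Strong convexity at \<open>x (Suc k)\<close>, compared with \<open>xstar\<close>, produces the dissipation
  \<open>- sqrt (\<mu> * s) * (1 - 3 * \<eta> * sqrt (\<mu> * s)) * E (Suc k)\<close> in the difference of the energies. Of what remains,
  \<open>F (x (Suc k)) - F (x k)\<close> is bounded by cocoercivity of the gradient, which leaves the term
  \<open>- 1 / (2 * L) * (norm (gF (x k) - gF (x (Suc k))))\<^sup>2\<close>. Completing one square in \<open>w (Suc k) - w k\<close> and
  one in \<open>gF (x k) - gF (x (Suc k))\<close> turns the remainder into a multiple of
  \<open>(norm (gF (x (Suc k))))\<^sup>2\<close>, and the condition on the step sizes says that its coefficient is
  nonpositive.\<close>

text \<open>Along the segment from \<open>x\<close> to \<open>x + v\<close>, \<open>h\<close> is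
  \<open>F\<close> minus the linear term and the quadratic term of the bound. The Lipschitz
  condition and Cauchy-Schwarz make its derivative nonpositive for \<open>t\<close> \<ge> 0, and
  \<open>h 1 \<le> h 0\<close> is the bound.\<close>

lemma lipschitz_gradient_descent:
  fixes F :: "'a::real_inner \<Rightarrow> real"
  assumes grad: "\<And>z. GDERIV F z :> gF z" and lip: "L-lipschitz_on UNIV gF"
  shows "F (x + v) \<le> F x + gF x \<bullet> v + L / 2 * (norm v)\<^sup>2"
proof -
  define h where "h t = F (x + t *\<^sub>R v) - t * (gF x \<bullet> v) - L / 2 * t\<^sup>2 * (norm v)\<^sup>2" for t
  have der: "(h has_real_derivative
      ((gF (x + t *\<^sub>R v) - gF x) \<bullet> v - L * t * (norm v)\<^sup>2)) (at t)" for t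
  proof -
    have "((\<lambda>t. x + t *\<^sub>R v) has_derivative (\<lambda>d. d *\<^sub>R v)) (at t)"
      by (auto intro!: derivative_eq_intros)
    moreover have "(F has_derivative (\<lambda>d. d \<bullet> gF (x + t *\<^sub>R v))) (at (x + t *\<^sub>R v))"
      using grad by (simp add: gderiv_def)
    ultimately have "((\<lambda>t. F (x + t *\<^sub>R v)) has_derivative (\<lambda>d. (d *\<^sub>R v) \<bullet> gF (x + t *\<^sub>R v))) (at t)"
      by (rule has_derivative_compose)
    then have "((\<lambda>t. F (x + t *\<^sub>R v)) has_real_derivative (gF (x + t *\<^sub>R v) \<bullet> v)) (at t)"
      by (rule has_derivative_imp_has_field_derivative) (simp add: inner_commute)
    then show ?thesis
      unfolding h_def[abs_def]
      by (auto intro!: derivative_eq_intros simp: inner_diff_left)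
  qed
  have nonpos: "(gF (x + t *\<^sub>R v) - gF x) \<bullet> v - L * t * (norm v)\<^sup>2 \<le> 0" if "0 \<le> t" for t
  proof -
    have "norm (gF (x + t *\<^sub>R v) - gF x) \<le> L * (t * norm v)"
      using lipschitz_onD[OF lip, of "x + t *\<^sub>R v" x] that by (simp add: dist_norm)
    then have "norm (gF (x + t *\<^sub>R v) - gF x) * norm v \<le> L * (t * norm v) * norm v"
      by (rule mult_right_mono) simp
    with norm_cauchy_schwarz[of "gF (x + t *\<^sub>R v) - gF x" v] show ?thesis
      by (simp add: power2_eq_square mult.assoc)
  qed
  have "h 1 \<le> h 0"
  proof (rule DERIV_nonpos_imp_nonincreasing[of 0 1 h])
    show "\<exists>D. (h has_real_derivative D) (at t) \<and> D \<le> 0" if "0 \<le> t" for t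
      using der nonpos[OF that] by (intro exI conjI)
  qed simp
  then show ?thesis
    by (simp add: h_def)
qed

text \<open>By convexity, \<open>x\<close> minimizes the tilted function
  \<open>F z - gF x \<bullet> z\<close>, whose gradient at \<open>y\<close> is \<open>d\<close>. A
  single gradient step from \<open>y\<close> cannot go below this minimum, while the descent bound
  says how much it gains.\<close>

lemma convex_lipschitz_gradient_cocoercive:
  fixes F :: "'a::real_inner \<Rightarrow> real"
  assumes grad: "\<And>z. GDERIV F z :> gF z" and lip: "L-lipschitz_on UNIV gF" and "L > 0"
    and convex: "\<And>x y. F y \<ge> F x + gF x \<bullet> (y - x)"
  shows "F y \<ge> F x + gF x \<bullet> (y - x) + 1 / (2 * L) * (norm (gF y - gF x))\<^sup>2"
proof -
  define d where "d = gF y - gF x"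
  \<comment> \<open>This \<open>v\<close> minimizes
    \<open>d \<bullet> v + L / 2 * (norm v)\<^sup>2\<close>, with value
    \<open>- (norm d)\<^sup>2 / (2 * L)\<close>.\<close>
  define v where "v = - (1 / L) *\<^sub>R d"
  have "F x + gF x \<bullet> (y + v - x) \<le> F y + gF y \<bullet> v + L / 2 * (norm v)\<^sup>2"
    using convex[of x "y + v"] lipschitz_gradient_descent[OF grad lip, of y v] by linarith
  then have "F x + gF x \<bullet> (y - x) - d \<bullet> v - L / 2 * (norm v)\<^sup>2 \<le> F y"
    by (simp add: d_def algebra_simps inner_diff_left inner_diff_right inner_add_right)
  moreover have "d \<bullet> v = - (norm d)\<^sup>2 / L"
    by (simp add: v_def dot_square_norm)
  moreover have "L / 2 * (norm v)\<^sup>2 = (norm d)\<^sup>2 / (2 * L)"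
    using \<open>L > 0\<close> by (simp add: v_def power2_eq_square)
  moreover have "(norm d)\<^sup>2 / L = 2 * ((norm d)\<^sup>2 / (2 * L))"
    by simp
  ultimately show ?thesis
    by (simp add: d_def)
qed

text \<open>Young's inequality: expand the square of \<open>c *\<^sub>R x - y\<close> and divide by
  \<open>2 * c\<close>. The weight is free because the two completed squares below take
  \<open>c = b\<close> and \<open>c = 1 / L\<close>.\<close>

lemma inner_le_weighted_squares:
  fixes x y :: "'a::real_inner"
  assumes "c > 0"
  shows "x \<bullet> y \<le> c / 2 * (norm x)\<^sup>2 + 1 / (2 * c) * (norm y)\<^sup>2"
proof -
  have "0 \<le> (norm (c *\<^sub>R x - y))\<^sup>2 / (2 * c)"
    using assms by simp
  also have "(norm (c *\<^sub>R x - y))\<^sup>2 = c\<^sup>2 * (norm x)\<^sup>2 + (norm y)\<^sup>2 - 2 * c * (x \<bullet> y)"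
    by (simp add: power2_norm_eq_inner inner_diff_left inner_diff_right inner_commute
        power2_eq_square[of c])
  finally show ?thesis
    using assms by (simp add: field_simps power2_eq_square)
qed

lemma le_powi_of_contraction:
  fixes a :: "nat \<Rightarrow> real"
  assumes "r > 0" and "\<And>k. r * a (Suc k) \<le> a k"
  shows "a k \<le> r powi (- int k) * a 0"
proof -
  \<comment> \<open>With the power on the left the induction only multiplies; the negative exponent
    appears after one final division.\<close>
  have "r ^ k * a k \<le> a 0"
  proof (induction k)
    case (Suc k)
    have "r ^ k * (r * a (Suc k)) \<le> r ^ k * a k"
      using assms by (intro mult_left_mono) auto
    with Suc show ?case
      by (simp add: mult_ac)
  qed simp
  then show ?thesis
    using \<open>r > 0\<close> by (simp add: power_int_minus field_simps)
qed

theorem theorem5p2: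
  fixes F :: "real ^ 'n \<Rightarrow> real" and gF :: "real ^ 'n \<Rightarrow> real ^ 'n"
    and L \<mu> s \<eta> b :: real and xstar :: "real ^ 'n"
    and x w :: "nat \<Rightarrow> real ^ 'n" and E :: "nat \<Rightarrow> real"
  assumes mu_pos: "\<mu> > 0" and L_ge: "L \<ge> \<mu>"
    and grad: "\<And>z. GDERIV F z :> gF z"
    and C1: "continuous_on UNIV gF"
    and strong: "strongly_convex \<mu> F gF"
    and lip: "L-lipschitz_on UNIV gF"
    and minimizer: "\<And>z. F xstar \<le> F z"
    and s_pos: "s > 0" and eta_pos: "\<eta> > 0"
    and x_step: "\<And>k. (x (Suc k) - x k) /\<^sub>R sqrt s
        = (sqrt \<mu> * (1 - 3 * \<eta> * sqrt (\<mu> * s))) *\<^sub>R (w k - x (Suc k))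
          - (3 / 2 * \<eta> * sqrt s) *\<^sub>R gF (x k)"
    and w_step: "\<And>k. (w (Suc k) - w k) /\<^sub>R sqrt s
        = - ((sqrt \<mu> / 2 * (2 + 5 * \<eta> * sqrt (\<mu> * s))) *\<^sub>R (w (Suc k) - x (Suc k)))
          - (1 / (2 * sqrt \<mu>) * (2 + 5 * \<eta> * sqrt (\<mu> * s))) *\<^sub>R gF (x (Suc k))"
    and small: "3 * \<eta> * sqrt (\<mu> * s) < 1"
    and cond: "9 * L * \<eta>\<^sup>2 * s
        + 4 * (1 + 5 / 2 * \<eta> * sqrt (\<mu> * s)) * (1 - 3 * \<eta> * sqrt (\<mu> * s)) \<le> 12 * \<eta>"
    and b_eq: "b = \<mu> * (1 - 3 * \<eta> * sqrt (\<mu> * s)) / (1 + 5 / 2 * \<eta> * sqrt (\<mu> * s))"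
    and E_eq: "\<And>k. E k = F (x k) - F xstar + b / 2 * (norm (w k - xstar))\<^sup>2"
  shows "(\<forall>k. E (Suc k) - E k \<le> - sqrt (\<mu> * s) * (1 - 3 * \<eta> * sqrt (\<mu> * s)) * E (Suc k))
    \<and> (\<forall>k. E k \<le> (1 + sqrt (\<mu> * s) * (1 - 3 * \<eta> * sqrt (\<mu> * s))) powi (- int k) * E 0)"
proof -
  \<comment> \<open>After multiplication by \<open>sqrt s\<close>, the coupling coefficients of the
    two updates become \<open>\<sigma> * q\<close> and \<open>\<sigma> * p\<close>.\<close>
  define \<sigma> where "\<sigma> = sqrt (\<mu> * s)"
  define q where "q = 1 - 3 * \<eta> * \<sigma>"
  define p where "p = 1 + 5 / 2 * \<eta> * \<sigma>"
  have \<sigma>: "\<sigma> > 0" "\<sigma>\<^sup>2 = \<mu> * s" "sqrt s * sqrt \<mu> = \<sigma>"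
    using mu_pos s_pos by (auto simp: \<sigma>_def real_sqrt_mult power_mult_distrib)
  have q: "q > 0" and p: "p \<ge> 1" and "q \<le> p"
    using small \<sigma> eta_pos by (auto simp: q_def p_def \<sigma>_def intro: order.trans[of _ 1])
  have b: "b = \<mu> * q / p"
    by (simp add: b_eq q_def p_def \<sigma>_def)
  \<comment> \<open>The weight \<open>b\<close> is chosen to trade the rate
    \<open>\<sigma> * p\<close> of the \<open>w\<close> update for the rate
    \<open>\<sigma> * q\<close> of the \<open>x\<close> update.\<close>
  have b_pos: "b > 0" and bp: "b * p = \<mu> * q"
    using q p mu_pos by (auto simp: b)
  have b_le: "b \<le> \<mu>"
    using p \<open>q \<le> p\<close> mu_pos by (simp add: b divide_le_eq)
  have L_pos: "L > 0"
    using mu_pos L_ge by simp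
  have cond': "9 * L * \<eta>\<^sup>2 * s + 4 * p * q \<le> 12 * \<eta>"
    using cond by (simp add: p_def q_def \<sigma>_def)
  have sc: "F y \<ge> F z + gF z \<bullet> (y - z) + \<mu> / 2 * (norm (z - y))\<^sup>2" for y z
    using strong by (auto simp: strongly_convex_def)
  have convex: "F y \<ge> F z + gF z \<bullet> (y - z)" for y z
  proof -
    have "0 \<le> \<mu> / 2 * (norm (z - y))\<^sup>2"
      using mu_pos by simp
    with sc[of z y] show ?thesis
      by linarith
  qed
  have step: "E (Suc k) - E k \<le> - \<sigma> * q * E (Suc k)" for k
  proof -
    define g where "g = gF (x k)"
    define g' where "g' = gF (x (Suc k))"
    define X where "X = x (Suc k)"
    define W where "W = w (Suc k)"
    have dx: "X - x k = (\<sigma> * q) *\<^sub>R (w k - X) - (3 / 2 * \<eta> * s) *\<^sub>R g"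
    proof -
      have "X - x k = sqrt s *\<^sub>R ((X - x k) /\<^sub>R sqrt s)"
        using s_pos by simp
      also have "\<dots> = (sqrt s * sqrt \<mu> * q) *\<^sub>R (w k - X) - (3 / 2 * \<eta> * (sqrt s * sqrt s)) *\<^sub>R g"
        unfolding X_def x_step g_def
        by (simp add: q_def \<sigma>_def scaleR_diff_right mult_ac)
      finally show ?thesis
        using \<sigma> s_pos by simp
    qed
    have dw: "W - w k = - ((\<sigma> * p) *\<^sub>R (W - X)) - (\<sigma> * p / \<mu>) *\<^sub>R g'"
    proof -
      have "W - w k = sqrt s *\<^sub>R ((W - w k) /\<^sub>R sqrt s)"
        using s_pos by simp
      also have "\<dots> = - ((sqrt s * sqrt \<mu> * p) *\<^sub>R (W - X)) - (sqrt s / sqrt \<mu> * p) *\<^sub>R g'"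
        unfolding X_def W_def w_step g'_def
        by (simp add: p_def \<sigma>_def scaleR_diff_right algebra_simps add_divide_distrib)
      also have "sqrt s / sqrt \<mu> = \<sigma> / \<mu>"
        using mu_pos by (simp add: \<sigma>(3)[symmetric] field_simps)
      finally show ?thesis
        using \<sigma> by simp
    qed
    \<comment> \<open>Expanding around the new point \<open>W\<close> yields a negative square of
      the increment, kept to absorb a cross term later.\<close>
    have "E (Suc k) - E k
        = F X - F (x k) + b * ((W - w k) \<bullet> (W - xstar)) - b / 2 * (norm (W - w k))\<^sup>2"
    proof -
      have "(norm (w k - xstar))\<^sup>2 = (norm (W - xstar))\<^sup>2 - 2 * ((W - w k) \<bullet> (W - xstar))
          + (norm (W - w k))\<^sup>2"
        by (simp add: power2_norm_eq_inner inner_diff_left inner_diff_right inner_commute)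
      then show ?thesis
        by (simp add: E_eq flip: X_def W_def) (simp add: ring_distribs add_divide_distrib diff_divide_distrib)
    qed
    moreover have "b * ((W - w k) \<bullet> (W - xstar))
        \<le> - \<sigma> * q * (\<mu> / 2 * (norm (W - xstar))\<^sup>2 + g' \<bullet> (W - X) + (F X - F xstar))"
    proof -
      have "b * ((W - w k) \<bullet> (W - xstar))
          = - \<sigma> * (b * p) * ((W - X) \<bullet> (W - xstar) + g' \<bullet> (W - xstar) / \<mu>)"
        unfolding dw by (simp add: inner_diff_left ring_distribs mult_ac)
      also have "\<dots> = - \<sigma> * q * (\<mu> * ((W - X) \<bullet> (W - xstar)) + g' \<bullet> (W - xstar))"
        unfolding bp using mu_pos by (simp add: field_simps)
      \<comment> \<open>Polarization produces
        \<open>- \<mu> / 2 * (norm (X - xstar))\<^sup>2\<close>, which the quadratic term of strong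
        convexity cancels exactly; the square of \<open>W - X\<close> is dropped.\<close>
      also have "\<dots> \<le> - \<sigma> * q * (\<mu> / 2 * (norm (W - xstar))\<^sup>2 + g' \<bullet> (W - X) + (F X - F xstar))"
      proof -
        have "(W - X) \<bullet> (W - xstar)
            = ((norm (W - X))\<^sup>2 + (norm (W - xstar))\<^sup>2 - (norm (X - xstar))\<^sup>2) / 2"
          by (simp add: power2_norm_eq_inner inner_diff_left inner_diff_right inner_commute)
        then have "\<mu> * ((W - X) \<bullet> (W - xstar)) = \<mu> / 2 * (norm (W - X))\<^sup>2
            + \<mu> / 2 * (norm (W - xstar))\<^sup>2 - \<mu> / 2 * (norm (X - xstar))\<^sup>2"
          by (simp add: ring_distribs add_divide_distrib diff_divide_distrib)
        moreover have "g' \<bullet> (W - xstar) = g' \<bullet> (W - X) - g' \<bullet> (xstar - X)"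
          by (simp add: inner_diff_right)
        moreover have "F xstar \<ge> F X + g' \<bullet> (xstar - X) + \<mu> / 2 * (norm (X - xstar))\<^sup>2"
          using sc by (simp add: g'_def X_def)
        moreover have "0 \<le> \<mu> / 2 * (norm (W - X))\<^sup>2"
          using mu_pos by simp
        ultimately have "\<mu> / 2 * (norm (W - xstar))\<^sup>2 + g' \<bullet> (W - X) + (F X - F xstar)
            \<le> \<mu> * ((W - X) \<bullet> (W - xstar)) + g' \<bullet> (W - xstar)"
          by linarith
        then show ?thesis
          using \<sigma> q by (intro mult_left_mono_neg) (auto simp: mult_le_0_iff)
      qed
      finally show ?thesis .
    qed
    \<comment> \<open>This collects everything outside the dissipation, including the term in
      \<open>g' \<bullet> (W - X)\<close> left by the previous estimate.\<close>
    moreover have "F X - F (x k) + \<sigma> * q * (g' \<bullet> (X - W)) - b / 2 * (norm (W - w k))\<^sup>2 \<le> 0"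
    proof -
      have "F X - F (x k) \<le> g' \<bullet> (X - x k) - 1 / (2 * L) * (norm (g - g'))\<^sup>2"
        using convex_lipschitz_gradient_cocoercive[OF grad lip L_pos convex, of X "x k"]
        by (simp add: g_def g'_def X_def inner_diff_right)
      moreover have "g' \<bullet> (X - x k) = \<sigma> * q * (g' \<bullet> (w k - X)) - 3 / 2 * \<eta> * s * (g' \<bullet> g)"
        unfolding dx by (simp add: inner_diff_right)
      \<comment> \<open>The equal factors \<open>\<sigma> * q\<close> let \<open>X\<close> drop out,
        so only the increment of \<open>w\<close> remains.\<close>
      moreover have "\<sigma> * q * (g' \<bullet> (w k - X)) + \<sigma> * q * (g' \<bullet> (X - W))
          = (W - w k) \<bullet> (- (\<sigma> * q) *\<^sub>R g')"
        by (simp add: inner_diff_right inner_diff_left inner_commute algebra_simps)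
      moreover have "(W - w k) \<bullet> (- (\<sigma> * q) *\<^sub>R g')
          \<le> b / 2 * (norm (W - w k))\<^sup>2 + s * p * q / 2 * (norm g')\<^sup>2"
      proof -
        \<comment> \<open>Insert \<open>\<sigma>\<^sup>2 = \<mu> * s\<close> and
          \<open>b = \<mu> * q / p\<close>.\<close>
        have "1 / (2 * b) * (norm (- (\<sigma> * q) *\<^sub>R g'))\<^sup>2 = s * p * q / 2 * (norm g')\<^sup>2"
          using \<sigma> q p mu_pos by (simp add: b power_mult_distrib power2_eq_square[of q] field_simps)
        with inner_le_weighted_squares[OF b_pos, of "W - w k" "- (\<sigma> * q) *\<^sub>R g'"] show ?thesis
          by simp
      qed
      \<comment> \<open>Writing \<open>g = g' + (g - g')\<close> isolates the good term
        \<open>- 3 / 2 * \<eta> * s * (norm g')\<^sup>2\<close>; the weight \<open>1 / L\<close>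
        matches the cocoercivity term.\<close>
      moreover have "- (3 / 2 * \<eta> * s * (g' \<bullet> g))
          \<le> 1 / (2 * L) * (norm (g - g'))\<^sup>2 + (9 / 8 * L * \<eta>\<^sup>2 * s - 3 / 2 * \<eta>) * s * (norm g')\<^sup>2"
      proof -
        have "(g - g') \<bullet> (- (3 / 2 * \<eta> * s) *\<^sub>R g')
            \<le> 1 / (2 * L) * (norm (g - g'))\<^sup>2 + L / 2 * (norm (- (3 / 2 * \<eta> * s) *\<^sub>R g'))\<^sup>2"
          using inner_le_weighted_squares[of "1 / L" "g - g'" "- (3 / 2 * \<eta> * s) *\<^sub>R g'"]
            L_pos by (simp add: mult.commute)
        moreover have "L / 2 * (norm (- (3 / 2 * \<eta> * s) *\<^sub>R g'))\<^sup>2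
            = 9 / 8 * L * \<eta>\<^sup>2 * s * s * (norm g')\<^sup>2"
          by (simp add: power_mult_distrib power2_eq_square)
        moreover have "(g - g') \<bullet> (- (3 / 2 * \<eta> * s) *\<^sub>R g')
            = 3 / 2 * \<eta> * s * (norm g')\<^sup>2 - 3 / 2 * \<eta> * s * (g' \<bullet> g)"
          by (simp add: power2_norm_eq_inner inner_diff_left inner_diff_right inner_commute
              field_simps)
        ultimately show ?thesis
          unfolding left_diff_distrib by linarith
      qed
      moreover have "s * p * q / 2 * (norm g')\<^sup>2
          + (9 / 8 * L * \<eta>\<^sup>2 * s - 3 / 2 * \<eta>) * s * (norm g')\<^sup>2 \<le> 0"
      proof -
        \<comment> \<open>The total coefficient of \<open>(norm g')\<^sup>2\<close> is
          \<open>s / 8\<close> times the step size condition.\<close>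
        have "(9 * L * \<eta>\<^sup>2 * s + 4 * p * q - 12 * \<eta>) * (s * (norm g')\<^sup>2 / 8) \<le> 0"
          using cond' s_pos by (intro mult_nonpos_nonneg) auto
        then show ?thesis
          by (simp add: algebra_simps)
      qed
      ultimately show ?thesis
        by linarith
    qed
    ultimately have "E (Suc k) - E k
        \<le> - \<sigma> * q * (\<mu> / 2 * (norm (W - xstar))\<^sup>2 + (F X - F xstar))"
      by (simp add: inner_diff_right algebra_simps)
    \<comment> \<open>Since \<open>b \<le> \<mu>\<close> and the outer factor is negative, lowering
      \<mu> to \<open>b\<close> weakens the bound and recovers the energy.\<close>
    also have "\<dots> \<le> - \<sigma> * q * (b / 2 * (norm (W - xstar))\<^sup>2 + (F X - F xstar))"
      using \<sigma> q b_le by (intro mult_left_mono_neg add_right_mono mult_right_mono) (auto simp: mult_le_0_iff)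
    finally show ?thesis
      by (simp add: E_eq X_def W_def add.commute)
  qed
  have "(1 + \<sigma> * q) * E (Suc k) \<le> E k" for k
    using step[of k] by (simp add: algebra_simps)
  then have "E k \<le> (1 + \<sigma> * q) powi (- int k) * E 0" for k
    by (intro le_powi_of_contraction) (use \<sigma> q in \<open>auto intro: add_pos_pos\<close>)
  with step show ?thesis
    by (simp add: \<sigma>_def q_def)
qed

end
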